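(* Let $n\ge2$. If $\rho:\mathfrak b^n\to\mathfrak{gl}(3,\mathbb C)$ is an indecomposable representation (with each $\rho(h_i)$ diagonalizable), then $\rho$ is one of the following. (i) $\rho|_{\mathfrak b^1}$ is indecomposable and $\rho(h_i)=\lambda_iI_3$, $\rho(y_i)=0$ for $i=2,3,\dots,n$, where the $\lambda_i$ are scalars. (ii) $$\rho(h_1)=\begin{pmatrix}\lambda_1&0&0\\0&\lambda_1-1&0\\0&0&\lambda_1\end{pmatrix},\ \rho(y_1)=\begin{pmatrix}0&0&0\\1&0&0\\0&0&0\end{pmatrix},\ \rho(h_2)=\begin{pmatrix}\lambda_2&0&0\\0&\lambda_2&0\\0&0&\lambda_2-1\end{pmatrix},\ \rho(y_2)=\begin{pmatrix}0&0&0\\0&0&0\\1&0&0\end{pmatrix}$$ and $\rho(h_i)=\lambda_iI_3$, $\rho(y_i)=0$ for $i=3,\dots,n$, where the $\lambda_i$ are all scalars. (iii) $$\rho(h_1)=\begin{pmatrix}\alpha_1-1&0&0\\0&\alpha_1&0\\0&0&\alpha_1-1\end{pmatrix},\ \rho(y_1)=\begin{pmatrix}0&0&0\\0&0&0\\0&1&0\end{pmatrix},\ \rho(h_2)=\begin{pmatrix}\alpha_2&0&0\\0&\alpha_2-1&0\\0&0&\alpha_2-1\end{pmatrix},\ \rho(y_2)=\begin{pmatrix}0&0&0\\0&0&0\\1&0&0\end{pmatrix}$$ and $\rho(h_i)=\alpha_iI_3$, $\rho(y_i)=0$ for $i=3,\dots,n$, where the $\alpha_i$ are all scalars.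
   Context: $\mathfrak b\subset\mathfrak{sl}(2,\mathbb C)$ is the Lie algebra of lower triangular matrices, spanned by $h=\frac12\begin{pmatrix}1&0\\0&-1\end{pmatrix}$ and $y=\begin{pmatrix}0&0\\1&0\end{pmatrix}$, with $[h,y]=-y$. $\mathfrak b^n$ is the direct sum of $n$ copies of $\mathfrak b$; $h_i$ and $y_i$ are the elements with $h$, respectively $y$, in the $i$-th slot and $0$ elsewhere; $\mathfrak b^1=\mathfrak b\oplus\{0\}\oplus\cdots\oplus\{0\}$. $I_3$ is the $3\times3$ identity matrix. A representation is indecomposable if its space is not the direct sum of two nonzero invariant subspaces.
   Formalization: "ρ is one of the following" is proved up to a change of basis of C^3 and a renumbering of the n copies of b; without renumbering it fails, e.g. n=2 with ρ(h_1) scalar, ρ(y_1)=0 and ρ restricted to the second copy indecomposable. *)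

theory Defs
  imports "HOL-Analysis.Analysis"
begin

text \<open>Complex \<open>m \<times> m\<close> matrices have type \<open>complex^'m^'m\<close>; \<open>A $ i $ j\<close> is the entry
  in row \<open>i\<close> and column \<open>j\<close>, and \<open>vector\<close> lists the rows.\<close>

definition cscale :: "complex \<Rightarrow> complex^'m^'m \<Rightarrow> complex^'m^'m"  (infixr "*\<^sub>C" 75)
  where "c *\<^sub>C A = (\<chi> i j. c * A $ i $ j)"

definition commutator :: "complex^'m^'m \<Rightarrow> complex^'m^'m \<Rightarrow> complex^'m^'m"
  where "commutator A B = A ** B - B ** A"

definition diagonalizable :: "complex^'m^'m \<Rightarrow> bool"
  where "diagonalizable A \<longleftrightarrow>
    (\<exists>P D :: complex^'m^'m. invertible P \<and> (\<forall>i j. i \<noteq> j \<longrightarrow> D $ i $ j = 0) \<and> A = P ** D ** matrix_inv P)"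

definition borel_sl2 :: "(complex^2^2) set"
  where "borel_sl2 = {A. trace A = 0 \<and> A $ 1 $ 2 = 0}"

definition h_mat :: "complex^2^2"
  where "h_mat = (1/2) *\<^sub>C vector [vector [1, 0], vector [0, -1]]"

definition y_mat :: "complex^2^2"
  where "y_mat = vector [vector [0, 0], vector [1, 0]]"

lemma borel_sl2_span: "borel_sl2 = {a *\<^sub>C h_mat + b *\<^sub>C y_mat | a b. True}"
proof (intro equalityI subsetI)
  fix A assume "A \<in> borel_sl2"
  then have "A $ 1 $ 1 + A $ 2 $ 2 = 0" "A $ 1 $ 2 = 0"
    by (auto simp: borel_sl2_def trace_def sum_2)
  then have "A = (2 * A $ 1 $ 1) *\<^sub>C h_mat + (A $ 2 $ 1) *\<^sub>C y_mat"
    by (simp add: vec_eq_iff forall_2 cscale_def h_mat_def y_mat_def add_eq_0_iff)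
  then show "A \<in> {a *\<^sub>C h_mat + b *\<^sub>C y_mat | a b. True}" by blast
qed (auto simp: borel_sl2_def trace_def sum_2 cscale_def h_mat_def y_mat_def)

lemma commutator_h_y: "commutator h_mat y_mat = - y_mat"
  by (simp add: vec_eq_iff forall_2 commutator_def matrix_matrix_mult_def sum_2
      cscale_def h_mat_def y_mat_def)

text \<open>An element of the direct sum of \<open>n\<close> copies is a family indexed by \<open>{1..n}\<close>, extended
  by \<open>0\<close> to all of \<open>nat\<close> so that equality of elements is equality of functions.
  All operations are slotwise.\<close>

definition bn :: "nat \<Rightarrow> (nat \<Rightarrow> complex^2^2) set"
  where "bn n = {X. (\<forall>i\<in>{1..n}. X i \<in> borel_sl2) \<and> (\<forall>i. i \<notin> {1..n} \<longrightarrow> X i = 0)}"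

definition in_slot :: "nat \<Rightarrow> complex^2^2 \<Rightarrow> nat \<Rightarrow> complex^2^2"
  where "in_slot i A = (\<lambda>j. if j = i then A else 0)"

definition h_slot :: "nat \<Rightarrow> nat \<Rightarrow> complex^2^2"
  where "h_slot i = in_slot i h_mat"

definition y_slot :: "nat \<Rightarrow> nat \<Rightarrow> complex^2^2"
  where "y_slot i = in_slot i y_mat"

definition b_summand :: "nat \<Rightarrow> (nat \<Rightarrow> complex^2^2) set"
  where "b_summand i = in_slot i ` borel_sl2"

definition bn_rep :: "nat \<Rightarrow> ((nat \<Rightarrow> complex^2^2) \<Rightarrow> complex^3^3) \<Rightarrow> bool"
  where "bn_rep n \<rho> \<longleftrightarrow>
    (\<forall>X\<in>bn n. \<forall>Y\<in>bn n. \<rho> (\<lambda>i. X i + Y i) = \<rho> X + \<rho> Y) \<and>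
    (\<forall>c. \<forall>X\<in>bn n. \<rho> (\<lambda>i. c *\<^sub>C X i) = c *\<^sub>C \<rho> X) \<and>
    (\<forall>X\<in>bn n. \<forall>Y\<in>bn n.
       \<rho> (\<lambda>i. commutator (X i) (Y i)) = commutator (\<rho> X) (\<rho> Y))"

definition invariant_subspace :: "'g set \<Rightarrow> ('g \<Rightarrow> complex^'m^'m) \<Rightarrow> (complex^'m) set \<Rightarrow> bool"
  where "invariant_subspace L \<rho> U \<longleftrightarrow> vec.subspace U \<and> (\<forall>X\<in>L. \<forall>u\<in>U. \<rho> X *v u \<in> U)"

text \<open>The parameter \<open>L\<close> is the acting Lie algebra; taking a smaller \<open>L\<close> gives
  indecomposability of the restriction of \<open>\<rho>\<close> to \<open>L\<close>.\<close>

definition indecomposable :: "'g set \<Rightarrow> ('g \<Rightarrow> complex^'m^'m) \<Rightarrow> bool"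
  where "indecomposable L \<rho> \<longleftrightarrow>
    \<not> (\<exists>U W. invariant_subspace L \<rho> U \<and> invariant_subspace L \<rho> W \<and> U \<noteq> {0} \<and> W \<noteq> {0} \<and>
          U \<inter> W = {0} \<and> {u + w | u w. u \<in> U \<and> w \<in> W} = UNIV)"

definition mat3 :: "complex \<Rightarrow> complex \<Rightarrow> complex \<Rightarrow> complex \<Rightarrow> complex \<Rightarrow> complex \<Rightarrow>
    complex \<Rightarrow> complex \<Rightarrow> complex \<Rightarrow> complex^3^3"
  where "mat3 a11 a12 a13 a21 a22 a23 a31 a32 a33 =
    vector [vector [a11, a12, a13], vector [a21, a22, a23], vector [a31, a32, a33]]"

definition type_i :: "nat \<Rightarrow> ((nat \<Rightarrow> complex^2^2) \<Rightarrow> complex^3^3) \<Rightarrow> bool"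
  where "type_i n \<rho> \<longleftrightarrow> indecomposable (b_summand 1) \<rho> \<and>
    (\<exists>l :: nat \<Rightarrow> complex. \<forall>i\<in>{2..n}. \<rho> (h_slot i) = mat (l i) \<and> \<rho> (y_slot i) = 0)"

definition type_ii :: "nat \<Rightarrow> ((nat \<Rightarrow> complex^2^2) \<Rightarrow> complex^3^3) \<Rightarrow> bool"
  where "type_ii n \<rho> \<longleftrightarrow> (\<exists>l :: nat \<Rightarrow> complex.
    \<rho> (h_slot 1) = mat3 (l 1)  0          0
                        0      (l 1 - 1)  0
                        0      0          (l 1) \<and>
    \<rho> (y_slot 1) = mat3 0 0 0
                        1 0 0
                        0 0 0 \<and>
    \<rho> (h_slot 2) = mat3 (l 2)  0      0
                        0      (l 2)  0
                        0      0      (l 2 - 1) \<and>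
    \<rho> (y_slot 2) = mat3 0 0 0
                        0 0 0
                        1 0 0 \<and>
    (\<forall>i\<in>{3..n}. \<rho> (h_slot i) = mat (l i) \<and> \<rho> (y_slot i) = 0))"

definition type_iii :: "nat \<Rightarrow> ((nat \<Rightarrow> complex^2^2) \<Rightarrow> complex^3^3) \<Rightarrow> bool"
  where "type_iii n \<rho> \<longleftrightarrow> (\<exists>a :: nat \<Rightarrow> complex.
    \<rho> (h_slot 1) = mat3 (a 1 - 1)  0      0
                        0          (a 1)  0
                        0          0      (a 1 - 1) \<and>
    \<rho> (y_slot 1) = mat3 0 0 0
                        0 0 0
                        0 1 0 \<and>
    \<rho> (h_slot 2) = mat3 (a 2)  0          0
                        0      (a 2 - 1)  0
                        0      0          (a 2 - 1) \<and>
    \<rho> (y_slot 2) = mat3 0 0 0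
                        0 0 0
                        1 0 0 \<and>
    (\<forall>i\<in>{3..n}. \<rho> (h_slot i) = mat (a i) \<and> \<rho> (y_slot i) = 0))"

text \<open>The matrices above are determined only up to the choice of a basis of \<open>\<complex>\<^sup>3\<close> (the matrix
  \<open>P\<close>) and up to the numbering of the copies of the Lie algebra (the permutation \<open>s\<close>).\<close>

definition change_basis_and_slots ::
    "complex^'m^'m \<Rightarrow> (nat \<Rightarrow> nat) \<Rightarrow> ((nat \<Rightarrow> complex^2^2) \<Rightarrow> complex^'m^'m) \<Rightarrow>
     (nat \<Rightarrow> complex^2^2) \<Rightarrow> complex^'m^'m"
  where "change_basis_and_slots P s \<rho> = (\<lambda>X. P ** \<rho> (X \<circ> s) ** matrix_inv P)"

end

theory Submission
  imports Defs
begin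

text \<open>Write \<open>H\<^sub>i\<close> and \<open>Y\<^sub>i\<close> for the images of the slot generators. All pairs of them commute,
  except that \<open>Y\<^sub>i\<close> lowers \<open>H\<^sub>i\<close>-eigenvalues by \<open>1\<close>. Call a slot \<open>i\<close> active if \<open>Y\<^sub>i \<noteq> 0\<close>.

  If slot \<open>i\<close> is inactive, then \<open>H\<^sub>i\<close> commutes with the whole representation, hence so do
  the spectral projections of this diagonalizable matrix. In an indecomposable representation a commuting idempotent is \<open>0\<close> or
  \<open>1\<close>, so \<open>H\<^sub>i\<close> is scalar (\<open>inactive_slot_scalar\<close>). With at most one active slot this is already
  type (i): the other slots act by scalars, so they preserve every subspace and cannot affect
  indecomposability (\<open>single_active_slot\<close>).

  Suppose two slots \<open>i \<noteq> j\<close> are active. Diagonalize \<open>H\<^sub>i\<close> and \<open>H\<^sub>j\<close> simultaneously and give every basis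
  vector its weight, the pair of its two eigenvalues. Draw an arrow from basis vector \<open>b\<close> to \<open>a\<close>
  for each nonzero entry in row \<open>a\<close> and column \<open>b\<close> of \<open>Y\<^sub>i\<close> or \<open>Y\<^sub>j\<close>. An arrow of \<open>Y\<^sub>i\<close> changes
  the weight by \<open>(-1, 0)\<close> and one of \<open>Y\<^sub>j\<close> by \<open>(0, -1)\<close>. Take one arrow of each kind. There are only three
  vertices, so the two arrows share one. If the head of one is the tail of the other, then one
  of \<open>Y\<^sub>i Y\<^sub>j\<close> and \<open>Y\<^sub>j Y\<^sub>i\<close> has a nonzero entry where the other has none, as the intermediate
  weight that it needs does not occur (\<open>no_chain\<close>). So the arrows have a common tail or a common
  head. In both cases the three weights are distinct and leave room for no further
  arrow, and ordering and rescaling the basis gives type (ii) or (iii) (\<open>two_active_slots\<close>).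
  For any other slot \<open>k\<close>, the matrices \<open>H\<^sub>k\<close> and \<open>Y\<^sub>k\<close> commute with \<open>H\<^sub>i\<close> and \<open>H\<^sub>j\<close>, so they are diagonal;
  then the commutator \<open>-Y\<^sub>k\<close> of \<open>H\<^sub>k\<close> and \<open>Y\<^sub>k\<close> vanishes (\<open>simple_joint_spectrum_no_shift\<close>), and \<open>H\<^sub>k\<close> is scalar as above.\<close>

section \<open>Conjugation of matrices\<close>

definition conjugate :: "complex^'m^'m \<Rightarrow> complex^'m^'m \<Rightarrow> complex^'m^'m"
  where "conjugate P A = P ** A ** matrix_inv P"

lemma matrix_inv_inverse:
  fixes P :: "complex^'m^'m"
  assumes "invertible P"
  shows "P ** matrix_inv P = mat 1" "matrix_inv P ** P = mat 1"
  using someI_ex[OF assms[unfolded invertible_def]] unfolding matrix_inv_def by auto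

lemma matrix_inv_eqI:
  fixes P :: "complex^'m^'m"
  assumes "Q ** P = mat 1"
  shows "invertible P" "matrix_inv P = Q"
proof -
  show "invertible P"
    using assms invertible_left_inverse by blast
  then show "matrix_inv P = Q"
    by (metis assms matrix_inv_inverse(1) matrix_mul_assoc matrix_mul_lid matrix_mul_rid)
qed

lemma matrix_inv_matrix_inv:
  fixes P :: "complex^'m^'m"
  assumes "invertible P"
  shows "invertible (matrix_inv P)" "matrix_inv (matrix_inv P) = P"
  using matrix_inv_eqI[OF matrix_inv_inverse(1)[OF assms]] by auto

lemma conjugate_conjugate:
  assumes "invertible P" "invertible Q"
  shows "conjugate P (conjugate Q A) = conjugate (P ** Q) A"
proof -
  have "matrix_inv Q ** matrix_inv P ** (P ** Q) = mat 1"
    by (metis assms matrix_inv_inverse(2) matrix_mul_assoc matrix_mul_lid)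
  then have "matrix_inv (P ** Q) = matrix_inv Q ** matrix_inv P"
    by (rule matrix_inv_eqI)
  then show ?thesis
    by (simp add: conjugate_def matrix_mul_assoc)
qed

lemma conjugate_mat_1 [simp]:
  fixes A :: "complex^'m^'m"
  shows "conjugate (mat 1) A = A"
proof -
  have "matrix_inv (mat 1 :: complex^'m^'m) = mat 1"
    by (rule matrix_inv_eqI) simp
  then show ?thesis
    by (simp add: conjugate_def)
qed

lemma conjugate_matrix_inv:
  assumes "invertible P"
  shows "conjugate (matrix_inv P) (conjugate P A) = A"
  using assms by (simp add: conjugate_conjugate matrix_inv_matrix_inv matrix_inv_inverse)

lemma conjugate_mult:
  assumes "invertible P"
  shows "conjugate P (A ** B) = conjugate P A ** conjugate P B"
  unfolding conjugate_def
  by (metis assms matrix_inv_inverse(2) matrix_mul_assoc matrix_mul_rid)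

lemma conjugate_add: "conjugate P (A + B) = conjugate P A + conjugate P B"
  by (simp add: conjugate_def vec_eq_iff matrix_matrix_mult_def distrib_left distrib_right
      sum.distrib)

lemma matrix_mult_zero [simp]:
  fixes A :: "complex^'m^'m"
  shows "A ** 0 = 0" "0 ** A = 0"
  by (simp_all add: vec_eq_iff matrix_matrix_mult_def)

lemma conjugate_0 [simp]: "conjugate P 0 = 0"
  by (simp add: conjugate_def)

lemma conjugate_eq_0_iff: "invertible P \<Longrightarrow> conjugate P A = 0 \<longleftrightarrow> A = 0"
  by (metis conjugate_0 conjugate_matrix_inv)

lemma conjugate_sum: "finite C \<Longrightarrow> conjugate P (\<Sum>c\<in>C. f c) = (\<Sum>c\<in>C. conjugate P (f c))"
  by (induction rule: finite_induct) (auto simp: conjugate_add)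

lemma matrix_mult_cscale:
  "A ** (c *\<^sub>C B) = c *\<^sub>C (A ** B)" "(c *\<^sub>C A) ** B = c *\<^sub>C (A ** B)"
  by (simp_all add: vec_eq_iff matrix_matrix_mult_def cscale_def sum_distrib_left mult_ac)

lemma cscale_mult_vec: "(c *\<^sub>C A) *v v = c *s (A *v v)"
  by (simp add: vec_eq_iff matrix_vector_mult_def cscale_def sum_distrib_left mult_ac)

lemma cscale_mat_1: "c *\<^sub>C mat 1 = mat c"
  by (simp add: vec_eq_iff cscale_def mat_def)

lemma mat_mult_vec: "mat c *v v = c *s (v :: complex^'m)"
  by (metis cscale_mat_1 cscale_mult_vec matrix_vector_mul_lid)

lemma conjugate_cscale: "conjugate P (c *\<^sub>C A) = c *\<^sub>C conjugate P A"
  by (simp add: conjugate_def matrix_mult_cscale)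

lemma conjugate_mat: "invertible P \<Longrightarrow> conjugate P (mat c) = mat c"
  unfolding cscale_mat_1[of c, symmetric] conjugate_cscale
  by (simp add: conjugate_def matrix_inv_inverse)

lemma diagonalizable_conjugate:
  "diagonalizable A \<longleftrightarrow>
    (\<exists>P D. invertible P \<and> (\<forall>i j. i \<noteq> j \<longrightarrow> D $ i $ j = 0) \<and> A = conjugate P D)"
  by (simp add: diagonalizable_def conjugate_def)

lemma diagonal_mult_nth:
  fixes D B :: "complex^'m^'m"
  assumes "\<forall>i j. i \<noteq> j \<longrightarrow> D $ i $ j = 0"
  shows "(D ** B) $ a $ b = D $ a $ a * B $ a $ b" "(B ** D) $ a $ b = B $ a $ b * D $ b $ b"
proof -
  have "(D ** B) $ a $ b = (\<Sum>k\<in>UNIV. if k = a then D $ a $ a * B $ a $ b else 0)"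
    unfolding matrix_matrix_mult_def vec_lambda_beta using assms by (intro sum.cong) auto
  then show "(D ** B) $ a $ b = D $ a $ a * B $ a $ b" by simp
  have "(B ** D) $ a $ b = (\<Sum>k\<in>UNIV. if k = b then B $ a $ b * D $ b $ b else 0)"
    unfolding matrix_matrix_mult_def vec_lambda_beta using assms by (intro sum.cong) auto
  then show "(B ** D) $ a $ b = B $ a $ b * D $ b $ b" by simp
qed

section \<open>Spectral projections and simultaneous diagonalization\<close>

text \<open>In a diagonalizing basis, \<open>E c\<close> is the diagonal \<open>0\<close>-\<open>1\<close> matrix that selects the
  eigenvalue \<open>c\<close>. A matrix commutes with a diagonal one exactly if it only links equal
  diagonal entries, so it then commutes with the selection as well; this replaces the
  usual argument that spectral projections are polynomials in \<open>A\<close>.\<close>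

lemma diagonalizable_spectral_projections:
  fixes A :: "complex^'m^'m"
  assumes "diagonalizable A"
  obtains C E where "finite C" "(\<Sum>c\<in>C. E c) = mat 1"
    "\<And>c. A ** E c = c *\<^sub>C E c" "\<And>c. E c ** E c = E c"
    "\<And>c B. A ** B = B ** A \<Longrightarrow> E c ** B = B ** E c"
proof -
  obtain P D where P: "invertible P" and D: "\<forall>i j. i \<noteq> j \<longrightarrow> D $ i $ j = 0"
    and A: "A = conjugate P D"
    using assms unfolding diagonalizable_conjugate by blast
  define C where "C = range (\<lambda>k. D $ k $ k)"
  define F :: "complex \<Rightarrow> complex^'m^'m"
    where "F c = (\<chi> a b. if a = b \<and> D $ a $ a = c then 1 else 0)" for c
  have F: "\<forall>i j. i \<noteq> j \<longrightarrow> F c $ i $ j = 0" for c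
    by (simp add: F_def)
  define E where "E c = conjugate P (F c)" for c
  have "finite C"
    by (simp add: C_def)
  moreover have "(\<Sum>c\<in>C. E c) = mat 1"
  proof -
    have "(\<Sum>c\<in>C. F c $ a $ b) = (mat 1 :: complex^'m^'m) $ a $ b" for a b
    proof -
      have "(\<Sum>c\<in>C. F c $ a $ b) = (\<Sum>c\<in>C. if c = D $ a $ a then (if a = b then 1 else 0) else 0)"
        by (intro sum.cong) (auto simp: F_def)
      also have "\<dots> = (mat 1 :: complex^'m^'m) $ a $ b"
        by (simp add: C_def mat_def)
      finally show ?thesis .
    qed
    then have "(\<Sum>c\<in>C. F c) = mat 1"
      by (simp add: vec_eq_iff)
    then show ?thesis
      using conjugate_mat[OF P, of 1] conjugate_sum[OF \<open>finite C\<close>, of P F] by (simp add: E_def)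
  qed
  moreover have "A ** E c = c *\<^sub>C E c" for c
  proof -
    have "D ** F c = c *\<^sub>C F c"
      by (simp add: vec_eq_iff diagonal_mult_nth[OF D]) (simp add: F_def cscale_def)
    then show ?thesis
      by (simp add: A E_def conjugate_mult[OF P, symmetric] conjugate_cscale)
  qed
  moreover have "E c ** E c = E c" for c
  proof -
    have "F c ** F c = F c"
      by (simp add: vec_eq_iff diagonal_mult_nth[OF F]) (simp add: F_def)
    then show ?thesis
      by (simp add: E_def conjugate_mult[OF P, symmetric])
  qed
  moreover have "E c ** B = B ** E c" if "A ** B = B ** A" for c B
  proof -
    define B' where "B' = conjugate (matrix_inv P) B"
    have B: "B = conjugate P B'"
      using conjugate_matrix_inv[OF matrix_inv_matrix_inv(1)[OF P], of B]
      by (simp add: B'_def matrix_inv_matrix_inv(2)[OF P])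
    have "conjugate P (D ** B') = conjugate P (B' ** D)"
      using that by (simp add: A B conjugate_mult[OF P])
    then have "D ** B' = B' ** D"
      by (metis conjugate_matrix_inv[OF P])
    then have "D $ a $ a * B' $ a $ b = B' $ a $ b * D $ b $ b" for a b
      by (metis diagonal_mult_nth[OF D])
    then have B': "B' $ a $ b = 0 \<or> D $ a $ a = D $ b $ b" for a b
      by (metis mult.commute mult_cancel_left)
    have "F c $ a $ a * B' $ a $ b = B' $ a $ b * F c $ b $ b" for a b
      using B'[of a b] by (auto simp: F_def)
    then have "F c ** B' = B' ** F c"
      by (simp add: vec_eq_iff diagonal_mult_nth[OF F])
    then show ?thesis
      by (simp add: B E_def conjugate_mult[OF P, symmetric])
  qed
  ultimately show ?thesis
    by (rule that)
qed

lemma sum_matrix_vec: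
  fixes E :: "'a \<Rightarrow> complex^'m^'m"
  shows "finite C \<Longrightarrow> (\<Sum>c\<in>C. E c) *v v = (\<Sum>c\<in>C. E c *v v)"
  by (induction rule: finite_induct) (auto simp: matrix_vector_mult_add_rdistrib)

text \<open>The projections \<open>F d\<close> of \<open>B\<close> commute with \<open>A\<close>, so they map the \<open>c\<close>-eigenspace of \<open>A\<close> to
  itself. Decomposing a vector first along \<open>A\<close> and then along \<open>B\<close> thus writes it as a sum
  of common eigenvectors.\<close>

lemma span_common_eigenvectors:
  fixes A B :: "complex^'m^'m"
  assumes "diagonalizable A" "diagonalizable B" "A ** B = B ** A"
  shows "vec.span {v. \<exists>a b. A *v v = a *s v \<and> B *v v = b *s v} = UNIV" (is "vec.span ?S = UNIV")
proof -
  obtain C E where C: "finite C" "(\<Sum>c\<in>C. E c) = mat 1" and AE: "\<And>c. A ** E c = c *\<^sub>C E c"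
    and "\<And>c. E c ** E c = E c" and E: "\<And>c X. A ** X = X ** A \<Longrightarrow> E c ** X = X ** E c"
    using diagonalizable_spectral_projections[OF assms(1)] by blast
  obtain D F where D: "finite D" "(\<Sum>d\<in>D. F d) = mat 1" and BF: "\<And>d. B ** F d = d *\<^sub>C F d"
    and "\<And>d. F d ** F d = F d" and F: "\<And>d X. B ** X = X ** B \<Longrightarrow> F d ** X = X ** F d"
    using diagonalizable_spectral_projections[OF assms(2)] by blast
  have "v \<in> vec.span ?S" for v
  proof -
    have "F d *v (E c *v v) \<in> ?S" for c d
    proof -
      have "A ** (F d ** E c) = c *\<^sub>C (F d ** E c)"
        by (metis AE F assms(3) matrix_mul_assoc matrix_mult_cscale(1))
      moreover have "B ** (F d ** E c) = d *\<^sub>C (F d ** E c)"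
        by (metis BF matrix_mul_assoc matrix_mult_cscale(2))
      ultimately show ?thesis
        by (metis (mono_tags, lifting) mem_Collect_eq cscale_mult_vec matrix_vector_mul_assoc)
    qed
    then have "(\<Sum>c\<in>C. \<Sum>d\<in>D. F d *v (E c *v v)) \<in> vec.span ?S"
      by (intro vec.span_sum vec.span_base)
    moreover have "(\<Sum>c\<in>C. \<Sum>d\<in>D. F d *v (E c *v v)) = v"
      by (simp add: C D sum_matrix_vec[symmetric])
    ultimately show ?thesis by simp
  qed
  then show ?thesis by blast
qed

lemma matrix_vec_axis:
  fixes A :: "complex^'n^'m"
  shows "A *v axis j 1 = column j A"
proof -
  have "(\<Sum>k\<in>UNIV. A $ i $ k * axis j 1 $ k) = (\<Sum>k\<in>UNIV. if k = j then A $ i $ j else 0)" for i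
    by (intro sum.cong) (auto simp: axis_def)
  then show ?thesis
    by (simp add: vec_eq_iff matrix_vector_mult_def column_def)
qed

lemma simultaneously_diagonalizable:
  fixes A B :: "complex^'m^'m"
  assumes "diagonalizable A" "diagonalizable B" "A ** B = B ** A"
  obtains P where "invertible P" "\<And>i j. i \<noteq> j \<Longrightarrow> conjugate P A $ i $ j = 0"
    "\<And>i j. i \<noteq> j \<Longrightarrow> conjugate P B $ i $ j = 0"
proof -
  let ?S = "{v. \<exists>a b. A *v v = a *s v \<and> B *v v = b *s v}"
  obtain V where V: "V \<subseteq> ?S" "vec.independent V" "?S \<subseteq> vec.span V"
    using vec.maximal_independent_subset by blast
  have span: "vec.span V = UNIV"
    using V span_common_eigenvectors[OF assms] vec.span_minimal[OF V(3) vec.subspace_span] by auto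
  then have "card V = vec.dim (UNIV :: (complex^'m) set)"
    by (metis V(2) vec.dim_span_eq_card_independent)
  then have "card V = CARD('m)"
    by (simp add: vec.dim_UNIV vec.dimension_def card_cart_basis)
  moreover have "finite V"
    using V(2) vec.finiteI_independent by blast
  ultimately obtain w :: "'m \<Rightarrow> complex^'m" where w: "bij_betw w UNIV V"
    by (metis finite_same_card_bij finite)
  define Q :: "complex^'m^'m" where "Q = (\<chi> i j. w j $ i)"
  have colQ: "column j Q = w j" for j
    by (simp add: Q_def column_def vec_eq_iff)
  have "columns Q = V"
    using w by (auto simp: columns_def colQ bij_betw_def)
  then have Q: "invertible Q"
    using span matrix_right_invertible_span_columns[of Q] invertible_right_inverse by auto
  have diag: "conjugate (matrix_inv Q) X $ i $ j = 0"
    if "i \<noteq> j" and X: "\<And>v. v \<in> V \<Longrightarrow> \<exists>x. X *v v = x *s v" for X i j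
  proof -
    obtain x where "X *v w j = x *s w j"
      using X w unfolding bij_betw_def by blast
    then have "X *v (Q *v axis j 1) = x *s (Q *v axis j 1)"
      by (simp only: matrix_vec_axis colQ)
    then have "matrix_inv Q *v (X *v (Q *v axis j 1)) = x *s axis j 1"
      using matrix_inv_inverse(2)[OF Q]
      by (simp add: vec.scale matrix_vector_mul_assoc)
    then have "conjugate (matrix_inv Q) X *v axis j 1 = x *s axis j 1"
      by (simp add: conjugate_def matrix_inv_matrix_inv[OF Q] matrix_vector_mul_assoc matrix_mul_assoc)
    then have "column j (conjugate (matrix_inv Q) X) $ i = (x *s axis j 1) $ i"
      by (simp only: matrix_vec_axis)
    then show ?thesis
      using \<open>i \<noteq> j\<close> by (simp add: column_def axis_def)
  qed
  show ?thesis
    by (rule that[of "matrix_inv Q"]) (use V in \<open>auto intro!: diag matrix_inv_matrix_inv Q\<close>)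
qed

text \<open>Passing to the basis vectors \<open>c b \<cdot> e\<^bsub>t b\<^esub>\<close>: the inverse of the matrix with these columns
  reads off the coordinates with respect to them.\<close>

lemma monomial_conjugate:
  fixes c :: "'m :: finite \<Rightarrow> complex" and t :: "'m \<Rightarrow> 'm"
  assumes "inj t" "\<And>a. c a \<noteq> 0"
  obtains P where "invertible P"
    "\<And>A a b. conjugate P A $ a $ b = A $ t a $ t b * c b / c a"
proof -
  define M :: "complex^'m^'m" where "M = (\<chi> x b. if x = t b then c b else 0)"
  define N :: "complex^'m^'m" where "N = (\<chi> a x. if x = t a then 1 / c a else 0)"
  have NX: "(N ** X) $ a $ b = X $ t a $ b / c a" for X :: "complex^'m^'m" and a b
  proof -
    have "(N ** X) $ a $ b = (\<Sum>k\<in>UNIV. if k = t a then X $ t a $ b / c a else 0)"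
      unfolding matrix_matrix_mult_def N_def vec_lambda_beta by (intro sum.cong) auto
    then show ?thesis by simp
  qed
  have XM: "(X ** M) $ a $ b = X $ a $ t b * c b" for X :: "complex^'m^'m" and a b
  proof -
    have "(X ** M) $ a $ b = (\<Sum>k\<in>UNIV. if k = t b then X $ a $ t b * c b else 0)"
      unfolding matrix_matrix_mult_def M_def vec_lambda_beta by (intro sum.cong) auto
    then show ?thesis by simp
  qed
  have "N ** M = mat 1"
    using assms by (auto simp: vec_eq_iff NX M_def mat_def dest: injD)
  then have "M ** N = mat 1"
    using matrix_left_right_inverse by blast
  note N = matrix_inv_eqI[OF this]
  show ?thesis
    by (rule that[OF N(1)]) (simp add: conjugate_def N(2) NX XM)
qed

section \<open>Pairs of active slots on a three-dimensional space\<close>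

text \<open>Since \<open>D\<close> is diagonal, both sides of the commutation relation multiply the entry of \<open>Y\<close>
  at \<open>(a, b)\<close> by a scalar, and a nonzero entry can be cancelled. The relation
  \<open>[D, Y] = -Y\<close> is written without differences, so that it carries over to conjugates
  by additivity and multiplicativity alone.\<close>

lemma weight_shift:
  fixes D Y :: "complex^'m^'m"
  assumes D: "\<And>i j. i \<noteq> j \<Longrightarrow> D $ i $ j = 0" and "Y $ a $ b \<noteq> 0"
  shows "D ** Y + Y = Y ** D \<Longrightarrow> D $ a $ a = D $ b $ b - 1"
    and "D ** Y = Y ** D \<Longrightarrow> D $ a $ a = D $ b $ b"
proof -
  have D': "\<forall>i j. i \<noteq> j \<longrightarrow> D $ i $ j = 0"
    using D by blast
  note mult = diagonal_mult_nth[OF D', of Y a b]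
  show "D $ a $ a = D $ b $ b - 1" if "D ** Y + Y = Y ** D"
  proof -
    have "D $ a $ a * Y $ a $ b + Y $ a $ b = Y $ a $ b * D $ b $ b"
      using arg_cong[OF that, of "\<lambda>A. A $ a $ b"] by (simp add: mult)
    then have "Y $ a $ b * (D $ a $ a - (D $ b $ b - 1)) = 0"
      by (simp add: algebra_simps)
    then show ?thesis
      using assms(2) by simp
  qed
  show "D $ a $ a = D $ b $ b" if "D ** Y = Y ** D"
    using arg_cong[OF that, of "\<lambda>A. A $ a $ b"] assms(2) by (simp add: mult)
qed

lemma UNIV_3_distinct:
  fixes p q r :: 3
  assumes "p \<noteq> q" "p \<noteq> r" "q \<noteq> r"
  shows "UNIV = {p, q, r}"
proof -
  have "card {p, q, r} = CARD(3)"
    using assms by simp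
  then show ?thesis
    by (metis card_subset_eq finite subset_UNIV)
qed

text \<open>Let \<open>w\<close> be the weight of \<open>p\<close>. The arrows \<open>p \<rightarrow> q \<rightarrow> r\<close> use up the weights \<open>w\<close>, \<open>w - (1, 0)\<close>
  and \<open>w - (1, 1)\<close>. The entry of \<open>Z2 Z1\<close> from \<open>p\<close> to \<open>r\<close> is the product of the two arrows,
  while \<open>Z1 Z2\<close> would have to pass through the weight \<open>w - (0, 1)\<close>, which is not
  there.\<close>

lemma no_chain:
  fixes Z1 Z2 :: "complex^3^3" and f g :: "3 \<Rightarrow> complex"
  assumes Z1: "\<And>a b. Z1 $ a $ b \<noteq> 0 \<Longrightarrow> f a = f b - 1 \<and> g a = g b"
    and Z2: "\<And>a b. Z2 $ a $ b \<noteq> 0 \<Longrightarrow> f a = f b \<and> g a = g b - 1"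
    and comm: "Z1 ** Z2 = Z2 ** Z1"
    and "Z1 $ q $ p \<noteq> 0" "Z2 $ r $ q \<noteq> 0"
  shows False
proof -
  have w: "f q = f p - 1" "g q = g p" "f r = f p - 1" "g r = g p - 1"
    using Z1[of q p] Z2[of r q] assms(4,5) by auto
  then have distinct: "p \<noteq> q" "p \<noteq> r" "q \<noteq> r"
    by auto
  note U = UNIV_3_distinct[OF distinct]
  have "Z1 $ p $ p = 0" "Z1 $ r $ p = 0" "Z2 $ p $ p = 0" "Z2 $ q $ p = 0" "Z2 $ r $ p = 0"
    using Z1[of p p] Z1[of r p] Z2[of p p] Z2[of q p] Z2[of r p] w by auto
  then have "(Z2 ** Z1) $ r $ p = Z2 $ r $ q * Z1 $ q $ p" "(Z1 ** Z2) $ r $ p = 0"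
    using distinct by (simp_all add: matrix_matrix_mult_def U)
  then show False
    using comm assms(4,5) by simp
qed

lemma reorder_rescale_3:
  fixes p q r :: 3 and x y z :: complex
  assumes "p \<noteq> q" "p \<noteq> r" "q \<noteq> r" "x \<noteq> 0" "y \<noteq> 0" "z \<noteq> 0"
  shows "\<exists>P. invertible P \<and> (\<forall>A. conjugate P A = mat3
        (A $ p $ p)          (A $ p $ q * y / x)  (A $ p $ r * z / x)
        (A $ q $ p * x / y)  (A $ q $ q)          (A $ q $ r * z / y)
        (A $ r $ p * x / z)  (A $ r $ q * y / z)  (A $ r $ r))"
proof -
  define t :: "3 \<Rightarrow> 3" where "t k = (if k = 1 then p else if k = 2 then q else r)" for k
  define c :: "3 \<Rightarrow> complex" where "c k = (if k = 1 then x else if k = 2 then y else z)" for k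
  have t: "t 1 = p" "t 2 = q" "t 3 = r" and c: "c 1 = x" "c 2 = y" "c 3 = z"
    by (simp_all add: t_def c_def)
  have "inj t"
    unfolding inj_def forall_3 t using assms by auto
  moreover have "c a \<noteq> 0" for a
    using assms by (simp add: c_def)
  ultimately obtain P where P: "invertible P"
    "\<And>A a b. conjugate P A $ a $ b = A $ t a $ t b * c b / c a"
    using monomial_conjugate[of t c] by blast
  show ?thesis
    by (intro exI[of _ P] conjI allI P(1))
      (use assms in \<open>simp add: vec_eq_iff forall_3 P(2) t c mat3_def\<close>)
qed

text \<open>The two configurations of two arrows with a common vertex: both arrows leave the first
  basis vector, or both enter the third.\<close>

definition common_source :: "complex^3^3 \<Rightarrow> complex^3^3 \<Rightarrow> complex^3^3 \<Rightarrow> complex^3^3 \<Rightarrow>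
    complex \<Rightarrow> complex \<Rightarrow> bool"
  where "common_source H1 Y1 H2 Y2 x y \<longleftrightarrow>
    H1 = mat3 x 0 0 0 (x - 1) 0 0 0 x \<and> Y1 = mat3 0 0 0 1 0 0 0 0 0 \<and>
    H2 = mat3 y 0 0 0 y 0 0 0 (y - 1) \<and> Y2 = mat3 0 0 0 0 0 0 1 0 0"

definition common_sink :: "complex^3^3 \<Rightarrow> complex^3^3 \<Rightarrow> complex^3^3 \<Rightarrow> complex^3^3 \<Rightarrow>
    complex \<Rightarrow> complex \<Rightarrow> bool"
  where "common_sink H1 Y1 H2 Y2 x y \<longleftrightarrow>
    H1 = mat3 (x - 1) 0 0 0 x 0 0 0 (x - 1) \<and> Y1 = mat3 0 0 0 0 0 0 0 1 0 \<and>
    H2 = mat3 y 0 0 0 (y - 1) 0 0 0 (y - 1) \<and> Y2 = mat3 0 0 0 0 0 0 1 0 0"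

text \<open>The function \<open>f\<close> gives the first and \<open>g\<close> the second component of the weights. Once the two arrows
  share their tail or their head, all three weights are known, and comparing them shows
  that no other entry of \<open>Z1\<close> or \<open>Z2\<close> can be nonzero.\<close>

lemma two_active_slots_diagonal:
  fixes D1 Z1 D2 Z2 :: "complex^3^3"
  assumes D1: "\<And>i j. i \<noteq> j \<Longrightarrow> D1 $ i $ j = 0" and D2: "\<And>i j. i \<noteq> j \<Longrightarrow> D2 $ i $ j = 0"
    and rel: "D1 ** Z1 + Z1 = Z1 ** D1" "D2 ** Z1 = Z1 ** D2"
      "D1 ** Z2 = Z2 ** D1" "D2 ** Z2 + Z2 = Z2 ** D2" "Z1 ** Z2 = Z2 ** Z1"
    and nz: "Z1 \<noteq> 0" "Z2 \<noteq> 0"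
  obtains P x y where "invertible P"
    "common_source (conjugate P D1) (conjugate P Z1) (conjugate P D2) (conjugate P Z2) x y \<or>
     common_sink (conjugate P D1) (conjugate P Z1) (conjugate P D2) (conjugate P Z2) x y"
proof -
  define f where "f a = D1 $ a $ a" for a
  define g where "g a = D2 $ a $ a" for a
  have W1: "f a = f b - 1 \<and> g a = g b" if "Z1 $ a $ b \<noteq> 0" for a b
    using weight_shift[OF D1 that] weight_shift[OF D2 that] rel by (simp add: f_def g_def)
  have W2: "f a = f b \<and> g a = g b - 1" if "Z2 $ a $ b \<noteq> 0" for a b
    using weight_shift[OF D1 that] weight_shift[OF D2 that] rel by (simp add: f_def g_def)
  have z1: "Z1 $ a $ b = 0" if "f a \<noteq> f b - 1 \<or> g a \<noteq> g b" for a b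
    using W1 that by blast
  have z2: "Z2 $ a $ b = 0" if "f a \<noteq> f b \<or> g a \<noteq> g b - 1" for a b
    using W2 that by blast
  have d: "D1 $ a $ a = f a" "D2 $ a $ a = g a" for a
    by (simp_all add: f_def g_def)
  obtain p q where pq: "Z1 $ q $ p \<noteq> 0"
    using nz(1) by (auto simp: vec_eq_iff)
  obtain p' q' where pq': "Z2 $ q' $ p' \<noteq> 0"
    using nz(2) by (auto simp: vec_eq_iff)
  have w: "f q = f p - 1" "g q = g p" and w': "f q' = f p'" "g q' = g p' - 1"
    using W1[OF pq] W2[OF pq'] by auto
  have "p \<noteq> q" "p' \<noteq> q'"
    using w w' by auto
  moreover have "\<forall>p q p' q' :: 3. p \<noteq> q \<longrightarrow> p' \<noteq> q' \<longrightarrow> p = p' \<or> q = q' \<or> q = p' \<or> p = q'"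
    by (simp add: forall_3)
  ultimately consider "p = p'" | "q = q'" | "q = p'" | "p = q'"
    by blast
  then show ?thesis
  proof cases
    case 1
    have distinct: "p \<noteq> q" "p \<noteq> q'" "q \<noteq> q'"
      using w w' 1 by auto
    obtain P where P: "invertible P"
      "\<And>A. conjugate P A = mat3
        (A $ p $ p)                      (A $ p $ q * (Z1 $ q $ p) / 1)
          (A $ p $ q' * (Z2 $ q' $ p) / 1)
        (A $ q $ p * 1 / (Z1 $ q $ p))   (A $ q $ q)
          (A $ q $ q' * (Z2 $ q' $ p) / (Z1 $ q $ p))
        (A $ q' $ p * 1 / (Z2 $ q' $ p)) (A $ q' $ q * (Z1 $ q $ p) / (Z2 $ q' $ p))
          (A $ q' $ q')"
      using reorder_rescale_3[OF distinct one_neq_zero pq pq'[folded 1]] by blast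
    show ?thesis
      by (rule that[OF P(1), of "f p" "g p"])
        (use distinct distinct[symmetric] pq pq' 1 w w' in \<open>simp add: common_source_def P(2) D1 D2 d z1 z2\<close>)
  next
    case 2
    have distinct: "p' \<noteq> p" "p' \<noteq> q" "p \<noteq> q"
      using w w' 2 by auto
    have v: "f q = f p - 1" "f p' = f p - 1" "g q = g p' - 1" "g p = g p' - 1"
      using w w' 2 by auto
    have nonzero: "Z2 $ q $ p' \<noteq> 0"
      using pq' 2 by simp
    (* Both arrows enter the third basis vector, so normalizing them to 1 rescales their tails
       by the inverse entries. *)
    have inv: "1 / Z2 $ q $ p' \<noteq> 0" "1 / Z1 $ q $ p \<noteq> 0"
      using nonzero pq by auto
    obtain P where P: "invertible P"
      "\<And>A. conjugate P A = mat3
        (A $ p' $ p')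
          (A $ p' $ p * (1 / Z1 $ q $ p) / (1 / Z2 $ q $ p')) (A $ p' $ q * 1 / (1 / Z2 $ q $ p'))
        (A $ p $ p' * (1 / Z2 $ q $ p') / (1 / Z1 $ q $ p))
          (A $ p $ p) (A $ p $ q * 1 / (1 / Z1 $ q $ p))
        (A $ q $ p' * (1 / Z2 $ q $ p') / 1)
          (A $ q $ p * (1 / Z1 $ q $ p) / 1) (A $ q $ q)"
      using reorder_rescale_3[OF distinct inv one_neq_zero] by blast
    show ?thesis
      by (rule that[OF P(1), of "f p" "g p'"])
        (use distinct distinct[symmetric] pq nonzero v in \<open>simp add: common_sink_def P(2) D1 D2 d z1 z2\<close>)
  next
    case 3
    then show ?thesis
      using no_chain[of Z1 f g Z2 q p q', OF W1 W2 rel(5)] pq pq' by blast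
  next
    case 4
    then show ?thesis
      using no_chain[of Z2 g f Z1 q' p' q, OF _ _ rel(5)[symmetric]] W1 W2 pq pq' by blast
  qed
qed

lemma two_active_slots:
  fixes H1 Y1 H2 Y2 :: "complex^3^3"
  assumes diag: "diagonalizable H1" "diagonalizable H2" "H1 ** H2 = H2 ** H1"
    and rel: "H1 ** Y1 + Y1 = Y1 ** H1" "H2 ** Y1 = Y1 ** H2"
      "H1 ** Y2 = Y2 ** H1" "H2 ** Y2 + Y2 = Y2 ** H2" "Y1 ** Y2 = Y2 ** Y1"
    and nz: "Y1 \<noteq> 0" "Y2 \<noteq> 0"
  obtains P x y where "invertible P"
    "common_source (conjugate P H1) (conjugate P Y1) (conjugate P H2) (conjugate P Y2) x y \<or>
     common_sink (conjugate P H1) (conjugate P Y1) (conjugate P H2) (conjugate P Y2) x y"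
proof -
  obtain Q where Q: "invertible Q"
    and D: "\<And>i j. i \<noteq> j \<Longrightarrow> conjugate Q H1 $ i $ j = 0"
      "\<And>i j. i \<noteq> j \<Longrightarrow> conjugate Q H2 $ i $ j = 0"
    using simultaneously_diagonalizable[OF diag] by blast
  note rel' = rel[THEN arg_cong[where f = "conjugate Q"],
      unfolded conjugate_add conjugate_mult[OF Q]]
  have nz': "conjugate Q Y1 \<noteq> 0" "conjugate Q Y2 \<noteq> 0"
    using nz by (simp_all add: conjugate_eq_0_iff[OF Q])
  obtain P x y where P: "invertible P" and normal_form:
    "common_source (conjugate P (conjugate Q H1)) (conjugate P (conjugate Q Y1)) (conjugate P (conjugate Q H2)) (conjugate P (conjugate Q Y2)) x y \<or>
     common_sink (conjugate P (conjugate Q H1)) (conjugate P (conjugate Q Y1)) (conjugate P (conjugate Q H2)) (conjugate P (conjugate Q Y2)) x y"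
    by (rule two_active_slots_diagonal[OF D rel' nz'])
  show ?thesis
    by (rule that[OF invertible_mult[OF P Q]])
      (use normal_form in \<open>simp add: conjugate_conjugate[OF P Q]\<close>)
qed

text \<open>When the pairs of diagonal entries of \<open>D1\<close> and \<open>D2\<close> are distinct, everything commuting with
  both is diagonal. So \<open>H\<close> and \<open>Y\<close> commute, and the relation \<open>[H, Y] = -Y\<close> leaves only \<open>Y = 0\<close>.\<close>

lemma simple_joint_spectrum_no_shift:
  fixes H Y :: "complex^'m^'m"
  assumes D1: "\<And>i j. i \<noteq> j \<Longrightarrow> D1 $ i $ j = 0" and D2: "\<And>i j. i \<noteq> j \<Longrightarrow> D2 $ i $ j = 0"
    and simple: "\<And>i j. D1 $ i $ i = D1 $ j $ j \<Longrightarrow> D2 $ i $ i = D2 $ j $ j \<Longrightarrow> i = j"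
    and H: "D1 ** H = H ** D1" "D2 ** H = H ** D2"
    and Y: "D1 ** Y = Y ** D1" "D2 ** Y = Y ** D2"
    and rel: "H ** Y + Y = Y ** H"
  shows "Y = 0"
proof (rule ccontr)
  have diagonal: "a = b" if "X $ a $ b \<noteq> 0" "D1 ** X = X ** D1" "D2 ** X = X ** D2" for X a b
    using weight_shift(2)[OF D1 that(1,2)] weight_shift(2)[OF D2 that(1,3)] simple by blast
  assume "Y \<noteq> 0"
  then obtain a b where ab: "Y $ a $ b \<noteq> 0"
    by (auto simp: vec_eq_iff)
  then have "a = b"
    using diagonal Y by blast
  moreover have "H $ a $ a = H $ b $ b - 1"
    by (rule weight_shift(1)[OF _ ab rel]) (use diagonal H in blast)
  ultimately show False by simp
qed

section \<open>Slots of the direct sum\<close>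

lemma borel_sl2_0: "0 \<in> borel_sl2"
  by (simp add: borel_sl2_def trace_def)

lemma h_mat_borel: "h_mat \<in> borel_sl2" and y_mat_borel: "y_mat \<in> borel_sl2"
  by (simp_all add: borel_sl2_def trace_def sum_2 cscale_def h_mat_def y_mat_def)

lemma cscale_0 [simp]: "c *\<^sub>C 0 = 0" "0 *\<^sub>C A = 0"
  by (simp_all add: vec_eq_iff cscale_def)

lemma cscale_minus_1: "(-1) *\<^sub>C A = - A"
  by (simp add: vec_eq_iff cscale_def)

lemma borel_sl2_cscale: "A \<in> borel_sl2 \<Longrightarrow> c *\<^sub>C A \<in> borel_sl2"
  by (simp add: borel_sl2_def trace_def cscale_def sum_distrib_left[symmetric])

lemma commutator_0 [simp]: "commutator A 0 = 0" "commutator 0 A = 0"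
  by (simp_all add: commutator_def)

lemma in_slot_bn: "i \<in> {1..n} \<Longrightarrow> A \<in> borel_sl2 \<Longrightarrow> in_slot i A \<in> bn n"
  by (auto simp: bn_def in_slot_def borel_sl2_0)

lemma h_slot_bn: "i \<in> {1..n} \<Longrightarrow> h_slot i \<in> bn n"
  and y_slot_bn: "i \<in> {1..n} \<Longrightarrow> y_slot i \<in> bn n"
  by (simp_all add: h_slot_def y_slot_def in_slot_bn h_mat_borel y_mat_borel)

lemma zero_bn: "(\<lambda>i. 0) \<in> bn n"
  by (simp add: bn_def borel_sl2_0)

lemma in_slot_comp:
  assumes "s permutes S"
  shows "in_slot i A \<circ> s = in_slot (inv s i) A"
  using permutes_inverses[OF assms] by (auto simp: in_slot_def fun_eq_iff)

lemma bn_rep_add: "bn_rep n \<rho> \<Longrightarrow> X \<in> bn n \<Longrightarrow> Y \<in> bn n \<Longrightarrow> \<rho> (\<lambda>i. X i + Y i) = \<rho> X + \<rho> Y"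
  and bn_rep_cscale: "bn_rep n \<rho> \<Longrightarrow> X \<in> bn n \<Longrightarrow> \<rho> (\<lambda>i. c *\<^sub>C X i) = c *\<^sub>C \<rho> X"
  and bn_rep_commutator: "bn_rep n \<rho> \<Longrightarrow> X \<in> bn n \<Longrightarrow> Y \<in> bn n \<Longrightarrow>
    \<rho> (\<lambda>i. commutator (X i) (Y i)) = commutator (\<rho> X) (\<rho> Y)"
  unfolding bn_rep_def by blast+

lemma bn_rep_zero:
  assumes "bn_rep n \<rho>"
  shows "\<rho> (\<lambda>i. 0) = 0"
  using bn_rep_cscale[OF assms zero_bn, of 0] by simp

lemma bn_rep_slots_commute:
  assumes "bn_rep n \<rho>" "i \<in> {1..n}" "j \<in> {1..n}" "A \<in> borel_sl2" "B \<in> borel_sl2" "i \<noteq> j"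
  shows "\<rho> (in_slot i A) ** \<rho> (in_slot j B) = \<rho> (in_slot j B) ** \<rho> (in_slot i A)"
proof -
  have "(\<lambda>k. commutator (in_slot i A k) (in_slot j B k)) = (\<lambda>k. 0)"
    using assms(6) by (auto simp: in_slot_def)
  then have "commutator (\<rho> (in_slot i A)) (\<rho> (in_slot j B)) = 0"
    using bn_rep_commutator[OF assms(1) in_slot_bn in_slot_bn, of i A j B] assms
    by (simp add: bn_rep_zero)
  then show ?thesis
    by (simp add: commutator_def)
qed

lemma bn_rep_h_y:
  assumes "bn_rep n \<rho>" "i \<in> {1..n}"
  shows "\<rho> (h_slot i) ** \<rho> (y_slot i) + \<rho> (y_slot i) = \<rho> (y_slot i) ** \<rho> (h_slot i)"
proof -
  have "(\<lambda>k. commutator (h_slot i k) (y_slot i k)) = (\<lambda>k. (-1) *\<^sub>C y_slot i k)"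
    by (auto simp: h_slot_def y_slot_def in_slot_def commutator_h_y cscale_minus_1)
  then have "commutator (\<rho> (h_slot i)) (\<rho> (y_slot i)) = - \<rho> (y_slot i)"
    using bn_rep_commutator[OF assms(1) h_slot_bn y_slot_bn, of i i]
      bn_rep_cscale[OF assms(1) y_slot_bn, of i "-1"] assms(2)
    by (simp add: cscale_minus_1)
  then show ?thesis
    by (simp add: commutator_def algebra_simps)
qed

lemma bn_rep_in_slot:
  assumes "bn_rep n \<rho>" "i \<in> {1..n}" "A = a *\<^sub>C h_mat + b *\<^sub>C y_mat"
  shows "\<rho> (in_slot i A) = a *\<^sub>C \<rho> (h_slot i) + b *\<^sub>C \<rho> (y_slot i)"
proof -
  have cscale: "(\<lambda>k. c *\<^sub>C in_slot i B k) = in_slot i (c *\<^sub>C B)" for c B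
    by (auto simp: in_slot_def)
  have "in_slot i A = (\<lambda>k. in_slot i (a *\<^sub>C h_mat) k + in_slot i (b *\<^sub>C y_mat) k)"
    by (auto simp: in_slot_def assms(3))
  then have "\<rho> (in_slot i A) = \<rho> (in_slot i (a *\<^sub>C h_mat)) + \<rho> (in_slot i (b *\<^sub>C y_mat))"
    using bn_rep_add[OF assms(1) in_slot_bn in_slot_bn] assms(2)
    by (simp add: borel_sl2_cscale h_mat_borel y_mat_borel)
  also have "\<dots> = a *\<^sub>C \<rho> (h_slot i) + b *\<^sub>C \<rho> (y_slot i)"
    using bn_rep_cscale[OF assms(1) h_slot_bn[OF assms(2)], of a]
      bn_rep_cscale[OF assms(1) y_slot_bn[OF assms(2)], of b]
    by (simp add: h_slot_def y_slot_def cscale)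
  finally show ?thesis .
qed

text \<open>An element of \<open>bn n\<close> is the sum of its slots, and each slot is spanned by \<open>h\<close> and \<open>y\<close>. So a
  linear condition on the image of \<open>\<rho>\<close> need only be checked on the generators. The proof
  adds the slots one at a time.\<close>

lemma bn_rep_induct [consumes 2, case_names zero add cscale h y]:
  assumes rep: "bn_rep n \<rho>" and "X \<in> bn n"
    and zero: "Q 0" and add: "\<And>A B. Q A \<Longrightarrow> Q B \<Longrightarrow> Q (A + B)"
    and cscale: "\<And>c A. Q A \<Longrightarrow> Q (c *\<^sub>C A)"
    and h: "\<And>i. i \<in> {1..n} \<Longrightarrow> Q (\<rho> (h_slot i))"
    and y: "\<And>i. i \<in> {1..n} \<Longrightarrow> Q (\<rho> (y_slot i))"
  shows "Q (\<rho> X)"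
proof -
  define trunc where "trunc m = (\<lambda>i. if i \<le> m then X i else 0)" for m
  have X: "X i \<in> borel_sl2" if "i \<in> {1..n}" for i
    using assms(2) that by (simp add: bn_def)
  have X0: "X i = 0" if "i \<notin> {1..n}" for i
    using assms(2) that by (simp add: bn_def)
  have "Q (\<rho> (trunc m))" if "m \<le> n" for m
    using that
  proof (induction m)
    case 0
    have "trunc 0 = (\<lambda>i. 0)"
      using X0 by (auto simp: trunc_def)
    then show ?case
      by (simp add: bn_rep_zero[OF rep] zero)
  next
    case (Suc m)
    let ?i = "Suc m"
    have i: "?i \<in> {1..n}"
      using Suc.prems by simp
    obtain a b where "X ?i = a *\<^sub>C h_mat + b *\<^sub>C y_mat"
      using X[OF i] unfolding borel_sl2_span by blast
    then have "\<rho> (in_slot ?i (X ?i)) = a *\<^sub>C \<rho> (h_slot ?i) + b *\<^sub>C \<rho> (y_slot ?i)"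
      by (rule bn_rep_in_slot[OF rep i])
    then have "Q (\<rho> (in_slot ?i (X ?i)))"
      using add cscale h[OF i] y[OF i] by simp
    moreover have "trunc m \<in> bn n"
      using assms(2) by (auto simp: trunc_def bn_def borel_sl2_0)
    then have "\<rho> (\<lambda>k. trunc m k + in_slot ?i (X ?i) k) = \<rho> (trunc m) + \<rho> (in_slot ?i (X ?i))"
      by (rule bn_rep_add[OF rep _ in_slot_bn[OF i X[OF i]]])
    moreover have "(\<lambda>k. trunc m k + in_slot ?i (X ?i) k) = trunc ?i"
      by (auto simp: trunc_def in_slot_def)
    ultimately show ?case
      using Suc add by simp
  qed
  moreover have "trunc n = X"
    using X0 by (auto simp: trunc_def)
  ultimately show ?thesis by auto
qed

section \<open>Consequences of indecomposability\<close>

text \<open>The fixed space and the kernel of \<open>T\<close> are complementary invariant subspaces, so one of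
  them is zero.\<close>

lemma indecomposable_commuting_idempotent:
  fixes T :: "complex^'m^'m"
  assumes "indecomposable L \<rho>" "T ** T = T" "\<And>X. X \<in> L \<Longrightarrow> T ** \<rho> X = \<rho> X ** T"
  shows "T = 0 \<or> T = mat 1"
proof (rule ccontr)
  assume "\<not> (T = 0 \<or> T = mat 1)"
  then obtain v w where v: "T *v v \<noteq> 0" and w: "T *v w \<noteq> w"
    by (metis matrix_eq matrix_vector_mul_lid matrix_vector_mult_0)
  define U where "U = {u. T *v u = u}"
  define W where "W = {u. T *v u = 0}"
  have TT: "T *v (T *v u) = T *v u" for u
    by (simp add: matrix_vector_mul_assoc assms(2))
  have T\<rho>: "T *v (\<rho> X *v u) = \<rho> X *v (T *v u)" if "X \<in> L" for X u
    using assms(3)[OF that] by (simp add: matrix_vector_mul_assoc)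
  have "vec.subspace U" "vec.subspace W"
    by (auto simp: vec.subspace_def U_def W_def vec.add vec.scale)
  then have "invariant_subspace L \<rho> U" "invariant_subspace L \<rho> W"
    by (auto simp: invariant_subspace_def U_def W_def T\<rho>)
  moreover have "T *v v \<in> U" "w - T *v w \<in> W"
    by (auto simp: U_def W_def TT vec.diff)
  then have "U \<noteq> {0}" "W \<noteq> {0}"
    using v w by auto
  moreover have "U \<inter> W = {0}"
    by (auto simp: U_def W_def)
  moreover have "{u + w | u w. u \<in> U \<and> w \<in> W} = UNIV"
  proof -
    have "x = T *v x + (x - T *v x) \<and> T *v x \<in> U \<and> x - T *v x \<in> W" for x
      by (auto simp: U_def W_def TT vec.diff)
    then show ?thesis by blast
  qed
  ultimately show False
    using assms(1) unfolding indecomposable_def by blast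
qed

text \<open>A form of Schur's lemma. Each spectral projection is \<open>0\<close> or \<open>1\<close>, and they add up to \<open>1\<close>, so one of them is
  the identity and \<open>A\<close> has only one eigenvalue.\<close>

lemma indecomposable_central_scalar:
  fixes A :: "complex^'m^'m"
  assumes "indecomposable L \<rho>" "diagonalizable A" "\<And>X. X \<in> L \<Longrightarrow> A ** \<rho> X = \<rho> X ** A"
  shows "\<exists>c. A = mat c"
proof -
  obtain C E where C: "finite C" "(\<Sum>c\<in>C. E c) = mat 1" and AE: "\<And>c. A ** E c = c *\<^sub>C E c"
    and idem: "\<And>c. E c ** E c = E c" and E: "\<And>c X. A ** X = X ** A \<Longrightarrow> E c ** X = X ** E c"
    using diagonalizable_spectral_projections[OF assms(2)] by blast
  have E01: "E c = 0 \<or> E c = mat 1" for c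
    by (rule indecomposable_commuting_idempotent[OF assms(1) idem]) (simp add: E assms(3))
  have "(mat 1 :: complex^'m^'m) \<noteq> 0"
    by (simp add: vec_eq_iff mat_def)
  then obtain c where "E c \<noteq> 0"
    using C(2) by (metis sum.neutral)
  then have "E c = mat 1"
    using E01 by blast
  then show ?thesis
    using AE[of c] by (auto simp: cscale_mat_1)
qed

lemma commutes_with_bn_rep:
  assumes "bn_rep n \<rho>" "X \<in> bn n"
    and "\<And>i. i \<in> {1..n} \<Longrightarrow> A ** \<rho> (h_slot i) = \<rho> (h_slot i) ** A"
    and "\<And>i. i \<in> {1..n} \<Longrightarrow> A ** \<rho> (y_slot i) = \<rho> (y_slot i) ** A"
  shows "A ** \<rho> X = \<rho> X ** A"
  using assms(1,2)
proof (induction rule: bn_rep_induct)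
  case (add B C)
  then show ?case
    by (simp add: vec_eq_iff matrix_matrix_mult_def distrib_left distrib_right sum.distrib)
qed (use assms(3,4) in \<open>simp_all add: matrix_mult_cscale\<close>)

lemma inactive_slot_scalar:
  assumes "bn_rep n \<rho>" "indecomposable (bn n) \<rho>" "j \<in> {1..n}" "diagonalizable (\<rho> (h_slot j))"
    and "\<rho> (y_slot j) = 0"
  shows "\<exists>c. \<rho> (h_slot j) = mat c"
proof (rule indecomposable_central_scalar[OF assms(2,4)])
  fix X assume "X \<in> bn n"
  with assms(1) show "\<rho> (h_slot j) ** \<rho> X = \<rho> X ** \<rho> (h_slot j)"
  proof (rule commutes_with_bn_rep)
    fix i assume i: "i \<in> {1..n}"
    have "\<rho> (h_slot j) ** \<rho> (in_slot i B) = \<rho> (in_slot i B) ** \<rho> (h_slot j)"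
      if "B \<in> borel_sl2" "i \<noteq> j" for B
      using bn_rep_slots_commute[OF assms(1,3) i h_mat_borel that(1)] that(2)
      by (simp add: h_slot_def)
    then show "\<rho> (h_slot j) ** \<rho> (h_slot i) = \<rho> (h_slot i) ** \<rho> (h_slot j)"
      "\<rho> (h_slot j) ** \<rho> (y_slot i) = \<rho> (y_slot i) ** \<rho> (h_slot j)"
      using assms(5) h_mat_borel y_mat_borel by (cases "i = j"; simp add: h_slot_def y_slot_def)+
  qed
qed

section \<open>The classification\<close>

text \<open>Composition with \<open>s\<close> moves the content of slot \<open>i\<close> to slot \<open>s\<^sup>-\<^sup>1 i\<close>, hence the inverse permutation.\<close>

lemma change_basis_and_slots_in_slot:
  assumes "s permutes S"
  shows "change_basis_and_slots P s \<rho> (in_slot i A) = conjugate P (\<rho> (in_slot (inv s i) A))"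
  by (simp add: change_basis_and_slots_def conjugate_def in_slot_comp[OF assms])

lemma change_basis_and_slots_h_y:
  assumes "s permutes S"
  shows "change_basis_and_slots P s \<rho> (h_slot i) = conjugate P (\<rho> (h_slot (inv s i)))"
    and "change_basis_and_slots P s \<rho> (y_slot i) = conjugate P (\<rho> (y_slot (inv s i)))"
  unfolding h_slot_def y_slot_def by (rule change_basis_and_slots_in_slot[OF assms])+

text \<open>A subspace that is invariant under slot \<open>k\<close> is invariant under all slots, since the others
  act by scalars and zeros; so a decomposition for slot \<open>k\<close> decomposes \<open>\<rho>\<close>.\<close>

lemma indecomposable_single_slot:
  assumes rep: "bn_rep n \<rho>" and ind: "indecomposable (bn n) \<rho>" and k: "k \<in> {1..n}"
    and inactive: "\<And>i. i \<in> {1..n} \<Longrightarrow> i \<noteq> k \<Longrightarrow> (\<exists>c. \<rho> (h_slot i) = mat c) \<and> \<rho> (y_slot i) = 0"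
  shows "indecomposable (b_summand k) \<rho>"
proof -
  have "invariant_subspace (bn n) \<rho> U" if U: "invariant_subspace (b_summand k) \<rho> U" for U
  proof -
    have sub: "vec.subspace U"
      using U by (simp add: invariant_subspace_def)
    have "\<forall>u\<in>U. \<rho> X *v u \<in> U" if "X \<in> bn n" for X
      using rep that
    proof (induction rule: bn_rep_induct)
      case (h i)
      show ?case
      proof (cases "i = k")
        case True
        then show ?thesis
          using U h_mat_borel by (auto simp: invariant_subspace_def b_summand_def h_slot_def)
      next
        case False
        then show ?thesis
          using inactive[OF h] by (auto simp: mat_mult_vec vec.subspace_scale[OF sub])
      qed
    next
      case (y i)
      show ?case
      proof (cases "i = k")
        case True
        then show ?thesis
          using U y_mat_borel by (auto simp: invariant_subspace_def b_summand_def y_slot_def)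
      next
        case False
        then show ?thesis
          using inactive[OF y] by (simp add: vec.subspace_0[OF sub])
      qed
    qed (simp_all add: matrix_vector_mult_add_rdistrib cscale_mult_vec
        vec.subspace_0[OF sub] vec.subspace_add[OF sub] vec.subspace_scale[OF sub])
    then show ?thesis
      using sub by (simp add: invariant_subspace_def)
  qed
  then have "\<not> indecomposable (bn n) \<rho>" if "\<not> indecomposable (b_summand k) \<rho>"
    using that unfolding indecomposable_def not_not by (elim ex_forward conj_forward)
  then show ?thesis
    using ind by blast
qed

text \<open>No change of basis is needed, because scalar and zero matrices look the same in every
  basis; only slot \<open>k\<close> has to be moved to the front.\<close>

lemma single_active_slot:
  assumes "bn_rep n \<rho>" "indecomposable (bn n) \<rho>" "k \<in> {1..n}"
    and "\<And>i. i \<in> {1..n} \<Longrightarrow> i \<noteq> k \<Longrightarrow> (\<exists>c. \<rho> (h_slot i) = mat c) \<and> \<rho> (y_slot i) = 0"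
  shows "\<exists>s. s permutes {1..n} \<and> type_i n (change_basis_and_slots (mat 1) s \<rho>)"
proof -
  define s where "s = Transposition.transpose 1 k"
  have s: "s permutes {1..n}"
    unfolding s_def using assms(3) by (intro permutes_swap_id) auto
  define \<rho>' where "\<rho>' = change_basis_and_slots (mat 1) s \<rho>"
  have inv_s: "inv s = s"
    by (simp add: s_def)
  then have s1: "inv s 1 = k"
    by (simp add: s_def)
  have "\<rho>' (in_slot 1 A) = \<rho> (in_slot k A)" for A
    by (simp add: \<rho>'_def change_basis_and_slots_in_slot[OF s] s1[simplified])
  then have "invariant_subspace (b_summand 1) \<rho>' U = invariant_subspace (b_summand k) \<rho> U" for U
    by (simp add: invariant_subspace_def b_summand_def)
  then have "indecomposable (b_summand 1) \<rho>'"
    using indecomposable_single_slot[OF assms] by (simp add: indecomposable_def)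
  moreover have "\<forall>i\<in>{2..n}. \<exists>c. \<rho>' (h_slot i) = mat c \<and> \<rho>' (y_slot i) = 0"
  proof
    fix i assume i: "i \<in> {2..n}"
    have "inv s i \<in> {1..n}"
      using i permutes_in_image[OF permutes_inv[OF s], of i] by simp
    moreover have "inv s i \<noteq> k"
      using i inj_eq[OF permutes_inj[OF permutes_inv[OF s]], of i 1] s1 by simp
    ultimately show "\<exists>c. \<rho>' (h_slot i) = mat c \<and> \<rho>' (y_slot i) = 0"
      using assms(4) by (simp add: \<rho>'_def change_basis_and_slots_h_y[OF s])
  qed
  then have "\<exists>l. \<forall>i\<in>{2..n}. \<rho>' (h_slot i) = mat (l i) \<and> \<rho>' (y_slot i) = 0"
    by (rule bchoice)
  ultimately show ?thesis
    using s unfolding type_i_def \<rho>'_def by blast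
qed

text \<open>The transposition of \<open>1\<close> and \<open>i\<close> brings \<open>i\<close> to the front and moves \<open>j\<close> to \<open>t \<noteq> 1\<close>; exchanging
  \<open>t\<close> with \<open>2\<close> then leaves \<open>1\<close> alone.\<close>

lemma permutation_to_front:
  assumes "i \<in> {1..n}" "j \<in> {1..n}" "i \<noteq> j"
  obtains s where "s permutes {1..n :: nat}" "inv s 1 = i" "inv s 2 = j"
proof -
  define t where "t = Transposition.transpose 1 i j"
  define s where "s = Transposition.transpose 2 t \<circ> Transposition.transpose 1 i"
  have n: "1 \<in> {1..n}" "2 \<in> {1..n}"
    using assms by auto
  have "t \<in> {1..n}"
    using assms by (auto simp: t_def Transposition.transpose_def)
  then have s: "s permutes {1..n}"
    unfolding s_def using assms n by (intro permutes_compose permutes_swap_id)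
  have t: "Transposition.transpose 1 i j = t"
    by (simp add: t_def)
  have "t \<noteq> 1"
    using assms(3) by (auto simp: t_def Transposition.transpose_def split: if_splits)
  then have "s i = 1" "s j = 2"
    unfolding s_def comp_apply t by simp_all
  then show ?thesis
    using permutes_inverses(2)[OF s, of i] permutes_inverses(2)[OF s, of j] by (intro that[OF s]) simp_all
qed

theorem corollary8p3:
  fixes n :: nat and \<rho> :: "(nat \<Rightarrow> complex^2^2) \<Rightarrow> complex^3^3"
  assumes "n \<ge> 2"
    and "bn_rep n \<rho>"
    and "\<forall>i\<in>{1..n}. diagonalizable (\<rho> (h_slot i))"
    and "indecomposable (bn n) \<rho>"
  shows "\<exists>P s. invertible P \<and> s permutes {1..n} \<and>
    (let \<rho>' = change_basis_and_slots P s \<rho>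
     in type_i n \<rho>' \<or> type_ii n \<rho>' \<or> type_iii n \<rho>')"
proof (cases "\<exists>k\<in>{1..n}. \<forall>i\<in>{1..n}. i \<noteq> k \<longrightarrow> \<rho> (y_slot i) = 0")
  case True
  then obtain k where k: "k \<in> {1..n}" "\<And>i. i \<in> {1..n} \<Longrightarrow> i \<noteq> k \<Longrightarrow> \<rho> (y_slot i) = 0"
    by blast
  have "\<exists>s. s permutes {1..n} \<and> type_i n (change_basis_and_slots (mat 1) s \<rho>)"
    using single_active_slot[OF assms(2,4) k(1)] k(2) inactive_slot_scalar[OF assms(2,4)] assms(3)
    by blast
  moreover have "invertible (mat 1 :: complex^3^3)"
    by (rule matrix_inv_eqI[of "mat 1"]) simp
  ultimately show ?thesis
    by (auto simp: Let_def)
next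
  case False
  have "1 \<in> {1..n}"
    using assms(1) by simp
  with False obtain i where i: "i \<in> {1..n}" "\<rho> (y_slot i) \<noteq> 0"
    by blast
  with False obtain j where j: "j \<in> {1..n}" "\<rho> (y_slot j) \<noteq> 0" "i \<noteq> j"
    by blast
  have comm: "\<rho> (h_slot a) ** \<rho> (h_slot b) = \<rho> (h_slot b) ** \<rho> (h_slot a)"
    "\<rho> (h_slot a) ** \<rho> (y_slot b) = \<rho> (y_slot b) ** \<rho> (h_slot a)"
    "\<rho> (y_slot a) ** \<rho> (y_slot b) = \<rho> (y_slot b) ** \<rho> (y_slot a)"
    if "a \<in> {1..n}" "b \<in> {1..n}" "a \<noteq> b" for a b
    using bn_rep_slots_commute[OF assms(2) that(1,2) _ _ that(3)] h_mat_borel y_mat_borel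
    by (simp_all add: h_slot_def y_slot_def)
  note hy = bn_rep_h_y[OF assms(2)]
  obtain P x y where P: "invertible P" and normal: "common_source (conjugate P (\<rho> (h_slot i))) (conjugate P (\<rho> (y_slot i)))
      (conjugate P (\<rho> (h_slot j))) (conjugate P (\<rho> (y_slot j))) x y \<or>
    common_sink (conjugate P (\<rho> (h_slot i))) (conjugate P (\<rho> (y_slot i)))
      (conjugate P (\<rho> (h_slot j))) (conjugate P (\<rho> (y_slot j))) x y"
    by (rule two_active_slots[OF _ _ comm(1)[OF i(1) j(1,3)] hy[OF i(1)]
        comm(2)[OF j(1) i(1) j(3)[symmetric]] comm(2)[OF i(1) j(1,3)] hy[OF j(1)]
        comm(3)[OF i(1) j(1,3)] i(2) j(2)])
      (use assms(3) i(1) j(1) in auto)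
  have diagonal: "conjugate P (\<rho> (h_slot i)) $ a $ b = 0" "conjugate P (\<rho> (h_slot j)) $ a $ b = 0"
    if "a \<noteq> b" for a b
    using normal that exhaust_3[of a] exhaust_3[of b] by (auto simp: common_source_def common_sink_def mat3_def)
  have simple: "a = b"
    if "conjugate P (\<rho> (h_slot i)) $ a $ a = conjugate P (\<rho> (h_slot i)) $ b $ b"
      "conjugate P (\<rho> (h_slot j)) $ a $ a = conjugate P (\<rho> (h_slot j)) $ b $ b" for a b
    using normal that exhaust_3[of a] exhaust_3[of b] by (auto simp: common_source_def common_sink_def mat3_def)
  have inactive: "(\<exists>c. conjugate P (\<rho> (h_slot k)) = mat c) \<and> conjugate P (\<rho> (y_slot k)) = 0"
    if k: "k \<in> {1..n}" "k \<noteq> i" "k \<noteq> j" for k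
  proof -
    have "conjugate P (\<rho> (y_slot k)) = 0"
      by (rule simple_joint_spectrum_no_shift[OF diagonal simple,
            where H = "conjugate P (\<rho> (h_slot k))"])
        (simp_all only: conjugate_mult[OF P, symmetric] conjugate_add[symmetric]
          comm(1,2)[OF i(1) k(1) k(2)[symmetric]] comm(1,2)[OF j(1) k(1) k(3)[symmetric]] hy[OF k(1)] not_False_eq_True)
    moreover from this have "\<rho> (y_slot k) = 0"
      by (simp add: conjugate_eq_0_iff[OF P])
    then have "\<exists>c. \<rho> (h_slot k) = mat c"
      using inactive_slot_scalar[OF assms(2,4) k(1)] assms(3) k(1) by blast
    then have "\<exists>c. conjugate P (\<rho> (h_slot k)) = mat c"
      by (auto simp: conjugate_mat[OF P])
    ultimately show ?thesis by blast
  qed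
  obtain s where s: "s permutes {1..n}" and s_ij: "inv s 1 = i" "inv s 2 = j"
    using permutation_to_front[OF i(1) j(1,3)] by blast
  define \<rho>' where "\<rho>' = change_basis_and_slots P s \<rho>"
  have \<rho>': "\<rho>' (h_slot a) = conjugate P (\<rho> (h_slot (inv s a)))"
    "\<rho>' (y_slot a) = conjugate P (\<rho> (y_slot (inv s a)))" for a
    by (simp_all add: \<rho>'_def change_basis_and_slots_h_y[OF s])
  have "\<forall>k\<in>{3..n}. \<exists>c. \<rho>' (h_slot k) = mat c \<and> \<rho>' (y_slot k) = 0"
  proof
    fix k assume k: "k \<in> {3..n}"
    have "inv s k \<in> {1..n}"
      using k permutes_in_image[OF permutes_inv[OF s], of k] by simp
    moreover have "inv s k \<noteq> i" "inv s k \<noteq> j"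
      using k inj_eq[OF permutes_inj[OF permutes_inv[OF s]], of k 1]
        inj_eq[OF permutes_inj[OF permutes_inv[OF s]], of k 2] s_ij by simp_all
    ultimately show "\<exists>c. \<rho>' (h_slot k) = mat c \<and> \<rho>' (y_slot k) = 0"
      using inactive by (simp add: \<rho>')
  qed
  then obtain c where c: "\<forall>k\<in>{3..n}. \<rho>' (h_slot k) = mat (c k) \<and> \<rho>' (y_slot k) = 0"
    using bchoice[of "{3..n}" "\<lambda>k c. \<rho>' (h_slot k) = mat c \<and> \<rho>' (y_slot k) = 0"] by blast
  define l where "l k = (if k = 1 then x else if k = 2 then y else c k)" for k :: nat
  have l: "l 1 = x" "l 2 = y" "\<forall>k\<in>{3..n}. \<rho>' (h_slot k) = mat (l k) \<and> \<rho>' (y_slot k) = 0"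
    using c by (auto simp: l_def)
  from normal have "type_ii n \<rho>' \<or> type_iii n \<rho>'"
  proof
    assume "common_source (conjugate P (\<rho> (h_slot i))) (conjugate P (\<rho> (y_slot i)))
      (conjugate P (\<rho> (h_slot j))) (conjugate P (\<rho> (y_slot j))) x y"
    then have "type_ii n \<rho>'"
      unfolding type_ii_def
      by (intro exI[of _ l] conjI l(3))
        (simp_all add: common_source_def \<rho>' s_ij l(1,2) del: One_nat_def)
    then show ?thesis ..
  next
    assume "common_sink (conjugate P (\<rho> (h_slot i))) (conjugate P (\<rho> (y_slot i)))
      (conjugate P (\<rho> (h_slot j))) (conjugate P (\<rho> (y_slot j))) x y"
    then have "type_iii n \<rho>'"
      unfolding type_iii_def
      by (intro exI[of _ l] conjI l(3))
        (simp_all add: common_sink_def \<rho>' s_ij l(1,2) del: One_nat_def)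
    then show ?thesis ..
  qed
  then show ?thesis
    using P s unfolding \<rho>'_def Let_def by blast
qed

end
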